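(* Let $v$ be a cooperative game on the three-player set $N=\{1,2,3\}$. Then: (a) If $v$ is semi-regular, then its Gately value is in its Core: $g(v)\in C(v)\neq\varnothing$. (b) If $C(v)\neq\varnothing$, then $v$ is semi-regular and $g(v)\in C(v)$.
   Context: A cooperative game on $N$ is a function $v\colon 2^N\to\mathbb R$ with $v(\varnothing)=0$. Write $v_i=v(\{i\})$ and $M_i(v)=v(N)-v(N\setminus\{i\})$ for $i\in N$. The game $v$ is semi-regular if it is essential, i.e. $\sum_{j\in N}v_j\leqslant v(N)\leqslant\sum_{j\in N}M_j(v)$, and semi-standard, i.e. $v_i\leqslant M_i(v)$ for every $i\in N$. The Core is $C(v)=\{x\in\mathbb R^N\mid \sum_{i\in N}x_i=v(N),\ \sum_{i\in S}x_i\geqslant v(S)\text{ for all }S\subseteq N\}$. For a semi-regular game $v$, the Gately value $g(v)\in\mathbb R^N$ is $$g_i(v)=v_i+\frac{M_i(v)-v_i}{\sum_{j\in N}(M_j(v)-v_j)}\Big(v(N)-\sum_{j\in N}v_j\Big),\qquad i\in N,$$ if $M_j(v)>v_j$ for at least one $j\in N$; and if $M_j(v)=v_j$ for all $j\in N$ (in which case $v(N)=\sum_{j\in N}v_j$), then $g(v)=(v_1,v_2,v_3)$. *)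

theory Defs
  imports "HOL-Analysis.Analysis"
begin

text \<open>The player set \<open>N\<close> is the universe of a finite type \<open>'n\<close>, coalitions are sets over
  \<open>'n\<close>, and allocations in \<open>\<real>\<^sup>N\<close> are vectors of type \<open>real ^ 'n\<close>.\<close>

definition cooperative_game :: "('n::finite set \<Rightarrow> real) \<Rightarrow> bool" where
  "cooperative_game v \<longleftrightarrow> v {} = 0"

definition individual_worth :: "('n::finite set \<Rightarrow> real) \<Rightarrow> 'n \<Rightarrow> real" where
  "individual_worth v i = v {i}"

definition marginal_contribution :: "('n::finite set \<Rightarrow> real) \<Rightarrow> 'n \<Rightarrow> real" where
  "marginal_contribution v i = v UNIV - v (UNIV - {i})"

definition essential :: "('n::finite set \<Rightarrow> real) \<Rightarrow> bool" where
  "essential v \<longleftrightarrow>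
     (\<Sum>j\<in>UNIV. individual_worth v j) \<le> v UNIV \<and>
     v UNIV \<le> (\<Sum>j\<in>UNIV. marginal_contribution v j)"

definition semi_standard :: "('n::finite set \<Rightarrow> real) \<Rightarrow> bool" where
  "semi_standard v \<longleftrightarrow> (\<forall>i. individual_worth v i \<le> marginal_contribution v i)"

definition semi_regular :: "('n::finite set \<Rightarrow> real) \<Rightarrow> bool" where
  "semi_regular v \<longleftrightarrow> essential v \<and> semi_standard v"

definition core :: "('n::finite set \<Rightarrow> real) \<Rightarrow> (real ^ 'n) set" where
  "core v = {x. (\<Sum>i\<in>UNIV. x $ i) = v UNIV \<and> (\<forall>S. v S \<le> (\<Sum>i\<in>S. x $ i))}"

text \<open>The Gately value is meaningful for semi-regular games only. For these, the else branch is
  exactly the case where marginal contribution and individual worth agree for all players;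
  outside this class the value is junk.\<close>

definition gately_value :: "('n::finite set \<Rightarrow> real) \<Rightarrow> real ^ 'n" where
  "gately_value v =
     (if \<exists>j. individual_worth v j < marginal_contribution v j
      then (\<chi> i. individual_worth v i +
              (marginal_contribution v i - individual_worth v i) /
              (\<Sum>j\<in>UNIV. marginal_contribution v j - individual_worth v j) *
              (v UNIV - (\<Sum>j\<in>UNIV. individual_worth v j)))
      else (\<chi> i. individual_worth v i))"

end

theory Submission imports Defs begin

text \<open>A semi-regular game has an efficient Gately value with \<open>v\<^sub>i \<le> g\<^sub>i \<le> M\<^sub>i\<close>: it moves from the
  vector of individual worths towards the vector of marginal contributions by a ratio in \<open>[0, 1]\<close>.
  For an efficient allocation \<open>x\<close>, the upper bound \<open>x\<^sub>i \<le> M\<^sub>i\<close> is the core inequality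
  of the coalition \<open>N - {i}\<close>. With three players, every coalition is empty, a singleton, the
  complement of a singleton, or \<open>N\<close>, so efficiency and these bounds already describe the core.\<close>

text \<open>Stability for \<open>{i}\<close> and, with efficiency, for \<open>UNIV - {i}\<close>
  squeezes each coordinate of a core allocation between individual worth and marginal contribution;
  summing over the players gives essentiality.\<close>

lemma semi_regular_if_core_nonempty:
  fixes v :: "'n::finite set \<Rightarrow> real"
  assumes "core v \<noteq> {}"
  shows "semi_regular v"
proof -
  obtain x where eff: "(\<Sum>i\<in>UNIV. x $ i) = v UNIV" and stable: "\<And>S. v S \<le> (\<Sum>i\<in>S. x $ i)"
    using assms by (auto simp: core_def)
  have lower: "individual_worth v i \<le> x $ i" for i
    using stable[of "{i}"] by (simp add: individual_worth_def)
  have upper: "x $ i \<le> marginal_contribution v i" for i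
    using stable[of "UNIV - {i}"] eff by (simp add: marginal_contribution_def sum_diff1)
  have "(\<Sum>j\<in>UNIV. individual_worth v j) \<le> v UNIV"
    unfolding eff[symmetric] by (intro sum_mono lower)
  moreover have "v UNIV \<le> (\<Sum>j\<in>UNIV. marginal_contribution v j)"
    unfolding eff[symmetric] by (intro sum_mono upper)
  ultimately show ?thesis
    unfolding semi_regular_def essential_def semi_standard_def
    using order_trans[OF lower upper] by blast
qed

lemma gately_value_semi_regular:
  fixes v :: "'n::finite set \<Rightarrow> real"
  assumes "semi_regular v"
  shows sum_gately_value: "(\<Sum>i\<in>UNIV. gately_value v $ i) = v UNIV"
    and individual_worth_le_gately_value: "individual_worth v i \<le> gately_value v $ i"
    and gately_value_le_marginal_contribution: "gately_value v $ i \<le> marginal_contribution v i"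
proof -
  let ?w = "individual_worth v" and ?M = "marginal_contribution v"
  define D where "D = (\<Sum>j\<in>UNIV. ?M j - ?w j)"
  define E where "E = v UNIV - (\<Sum>j\<in>UNIV. ?w j)"
  have wM: "?w j \<le> ?M j" for j
    using assms by (simp add: semi_regular_def semi_standard_def)
  \<comment> \<open>The two halves of essentiality, each with the sum of individual worths
    subtracted.\<close>
  have E: "0 \<le> E" "E \<le> D"
    using assms by (auto simp: semi_regular_def essential_def E_def D_def sum_subtractf)
  \<comment> \<open>If \<open>D = 0\<close> then \<open>w = M\<close>, so both branches of the definition agree with this formula.\<close>
  have g: "gately_value v $ i = ?w i + (E / D) * (?M i - ?w i)" for i
  proof (cases "\<exists>j. ?w j < ?M j")
    case True
    then show ?thesis by (simp add: gately_value_def E_def D_def)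
  next
    case False
    then have "?M i = ?w i" using wM[of i] by (meson not_less order_antisym)
    then show ?thesis using False by (simp add: gately_value_def)
  qed
  \<comment> \<open>If \<open>D = 0\<close>, then \<open>E = 0\<close> as well, and
    \<open>E / D = 0\<close> by the convention for division by zero, so all three claims
    survive.\<close>
  have t: "0 \<le> E / D" "E / D \<le> 1" "E / D * D = E"
    using E by (auto simp: divide_le_eq_1)
  show "(\<Sum>i\<in>UNIV. gately_value v $ i) = v UNIV"
    unfolding g sum.distrib sum_distrib_left[symmetric] D_def[symmetric] t(3)
    by (simp add: E_def)
  have d: "0 \<le> ?M i - ?w i"
    using wM[of i] by simp
  show "?w i \<le> gately_value v $ i"
    using mult_nonneg_nonneg[OF t(1) d] unfolding g by linarith
  show "gately_value v $ i \<le> ?M i"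
    using mult_left_le_one_le[OF d t(1,2)] unfolding g le_diff_eq by (simp only: add.commute)
qed

text \<open>The sizes of \<open>S\<close> and \<open>- S\<close> add up to 3, so one of the two sets
  has at most one element.\<close>

lemma coalition_three_cases:
  fixes S :: "3 set"
  obtains "S = {}" | i where "S = {i}" | i where "S = UNIV - {i}" | "S = UNIV"
proof -
  have compl: "card (- S) = 3 - card S"
    by (simp add: Compl_eq_Diff_UNIV card_Diff_subset)
  have "card S \<le> 3"
    using card_mono[OF finite subset_UNIV, of S] by simp
  then consider "card S = 0" | "card S = 1" | "card (- S) = 1" | "card (- S) = 0"
    unfolding compl by linarith
  then show ?thesis
  proof cases
    case 1
    with that(1) show ?thesis by simp
  next
    case 2
    with that(2) show ?thesis by (auto simp: card_1_singleton_iff)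
  next
    case 3
    then obtain i where "- S = {i}" by (auto simp: card_1_singleton_iff)
    then have "S = UNIV - {i}" by blast
    with that(3) show ?thesis .
  next
    case 4
    then have "- S = {}" by simp
    with that(4) show ?thesis by blast
  qed
qed

lemma core_three_playersI:
  fixes v :: "3 set \<Rightarrow> real"
  assumes "cooperative_game v"
    and eff: "(\<Sum>i\<in>UNIV. x $ i) = v UNIV"
    and lower: "\<And>i. individual_worth v i \<le> x $ i"
    and upper: "\<And>i. x $ i \<le> marginal_contribution v i"
  shows "x \<in> core v"
proof -
  have "v S \<le> (\<Sum>i\<in>S. x $ i)" for S
  proof (cases S rule: coalition_three_cases)
    case 1
    with assms(1) show ?thesis by (simp add: cooperative_game_def)
  next
    case (2 i)
    with lower[of i] show ?thesis by (simp add: individual_worth_def)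
  next
    case (3 i)
    with upper[of i] eff show ?thesis by (simp add: marginal_contribution_def sum_diff1)
  next
    case 4
    with eff show ?thesis by simp
  qed
  with eff show "x \<in> core v" by (simp add: core_def)
qed

theorem theorem4p2:
  fixes v :: "3 set \<Rightarrow> real"
  assumes "cooperative_game v"
  shows "(semi_regular v \<longrightarrow> gately_value v \<in> core v \<and> core v \<noteq> {}) \<and>
         (core v \<noteq> {} \<longrightarrow> semi_regular v \<and> gately_value v \<in> core v)"
proof -
  \<comment> \<open>Part (b) also follows from this, as a nonempty core forces
    semi-regularity.\<close>
  have "gately_value v \<in> core v" if "semi_regular v"
    using gately_value_semi_regular[OF that] by (intro core_three_playersI assms)
  then show ?thesis
    using semi_regular_if_core_nonempty by blast
qed

end
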